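(* Every uniform algebra $\mathcal{A}$ has simple ACK structure, i.e. $\mathcal{A}\in\mathrm{ACK}$.
   Context: A uniform algebra is a closed subalgebra $\mathcal{A}\subset C(K)$ ($K$ a compact Hausdorff space, $C(K)$ the complex-valued continuous functions with sup-norm) that separates the points of $K$; it is viewed as a Banach space with the sup-norm. $B_X$, $S_X$ are the closed unit ball and unit sphere of a Banach space $X$; $L(X)$ is the space of bounded linear operators on $X$; $w^*$ is the weak-star topology; $\mathrm{aco}\{0,V\}$ is the absolutely convex hull of $V\cup\{0\}$. A set $\Gamma\subset B_{X^*}$ is $1$-norming if $\|x\|=\sup_{x^*\in\Gamma}|x^*(x)|$ for all $x\in X$. Simple ACK structure. A Banach space $X$ has simple ACK structure ($X\in\mathrm{ACK}$) if there is a $1$-norming set $\Gamma\subset B_{X^*}$ such that for every $\varepsilon>0$ and every non-empty relatively $w^*$-open $U\subset\Gamma$ there exist a non-empty $V\subset U$, vectors $x_1^*\in V$, $e\in S_X$ and an operator $F\in L(X)$ with: (I) $\|Fe\|=\|F\|=1$; (II) $x_1^*(Fe)=1$; (III) $F^*x_1^*=x_1^*$; (IV)' $\|F^*x^*\|+(1-\varepsilon)\|(I_{X^*}-F^* )(x^* )\|\le 1$ for every $x^*\in\Gamma$; (V) $\mathrm{dist}(F^*x^*,\mathrm{aco}\{0,V\})<\varepsilon$ for every $x^*\in\Gamma$; (VI) $|v^*(e)-1|\le\varepsilon$ for every $v^*\in V$. *)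

theory Defs
  imports "HOL-Analysis.Analysis"
begin

section \<open>Banach spaces given by a carrier\<close>

text \<open>
  A Banach space over the field \<open>'f\<close> (the reals or the complex numbers) is a complete subspace
  \<open>X\<close> of an ambient normed space \<open>'a\<close> with scalar multiplication \<open>s\<close>.  The scalar multiplication
  is a parameter because the library has no type class for complex normed spaces; only the norm
  and the addition are taken from the class of \<open>'a\<close>.
\<close>

locale banach_space_on = vector_space s
  for s :: "'f::real_normed_field \<Rightarrow> 'a::real_normed_vector \<Rightarrow> 'a" +
  fixes X :: "'a set"
  assumes norm_scale: "norm (s c x) = norm c * norm x"
    and subspace_carrier: "subspace X"
    and complete_carrier: "complete X"

definition bounded_linear_on ::
    "('f \<Rightarrow> 'a \<Rightarrow> 'a) \<Rightarrow> ('f \<Rightarrow> 'b \<Rightarrow> 'b) \<Rightarrow> 'a set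
      \<Rightarrow> ('a::real_normed_vector \<Rightarrow> 'b::real_normed_vector) \<Rightarrow> bool" where
  "bounded_linear_on s t X T \<longleftrightarrow>
     (\<forall>x\<in>X. \<forall>y\<in>X. T (x + y) = T x + T y) \<and>
     (\<forall>c. \<forall>x\<in>X. T (s c x) = t c (T x)) \<and>
     (\<exists>B. \<forall>x\<in>X. norm (T x) \<le> B * norm x)"

definition opnorm_on :: "'a::real_normed_vector set \<Rightarrow> ('a \<Rightarrow> 'b::real_normed_vector) \<Rightarrow> real" where
  "opnorm_on X T = (SUP x\<in>{x \<in> X. norm x \<le> 1}. norm (T x))"

definition operators :: "('f \<Rightarrow> 'a \<Rightarrow> 'a) \<Rightarrow> 'a::real_normed_vector set \<Rightarrow> ('a \<Rightarrow> 'a) set" where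
  "operators s X = {T. T ` X \<subseteq> X \<and> bounded_linear_on s s X T}"

text \<open>
  Functionals on \<open>X\<close> are represented by extensional functions, so that equality in the dual is
  equality of functions and the topology of pointwise convergence on \<open>X\<close>, i.e. the weak-star
  topology, is a subspace of the product topology.
\<close>

definition dual :: "('f \<Rightarrow> 'a \<Rightarrow> 'a) \<Rightarrow> 'a set \<Rightarrow> ('a::real_normed_vector \<Rightarrow> 'f::real_normed_field) set" where
  "dual s X = {\<phi> \<in> extensional X. bounded_linear_on s (*) X \<phi>}"

definition dual_ball :: "('f \<Rightarrow> 'a \<Rightarrow> 'a) \<Rightarrow> 'a set \<Rightarrow> ('a::real_normed_vector \<Rightarrow> 'f::real_normed_field) set" where
  "dual_ball s X = {\<phi> \<in> dual s X. opnorm_on X \<phi> \<le> 1}"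

definition weak_star ::
    "('f \<Rightarrow> 'a \<Rightarrow> 'a) \<Rightarrow> 'a set \<Rightarrow> ('a::real_normed_vector \<Rightarrow> 'f::real_normed_field) topology" where
  "weak_star s X = subtopology (product_topology (\<lambda>_. euclidean) X) (dual s X)"

definition dual_minus :: "'a set \<Rightarrow> ('a \<Rightarrow> 'f) \<Rightarrow> ('a \<Rightarrow> 'f) \<Rightarrow> ('a \<Rightarrow> 'f::real_normed_field)" where
  "dual_minus X \<phi> \<psi> = (\<lambda>x\<in>X. \<phi> x - \<psi> x)"

definition adjoint_on :: "'a set \<Rightarrow> ('a \<Rightarrow> 'a) \<Rightarrow> ('a \<Rightarrow> 'f) \<Rightarrow> ('a \<Rightarrow> 'f)" where
  "adjoint_on X F \<phi> = (\<lambda>x\<in>X. \<phi> (F x))"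

definition dual_aco :: "'a set \<Rightarrow> ('a \<Rightarrow> 'f) set \<Rightarrow> ('a \<Rightarrow> 'f::real_normed_field) set" where
  "dual_aco X W = {(\<lambda>x\<in>X. \<Sum>\<psi>\<in>T. c \<psi> * \<psi> x) | T c.
     finite T \<and> T \<subseteq> W \<and> (\<Sum>\<psi>\<in>T. norm (c \<psi>)) \<le> 1}"

definition dual_dist ::
    "'a set \<Rightarrow> ('a::real_normed_vector \<Rightarrow> 'f::real_normed_field) \<Rightarrow> ('a \<Rightarrow> 'f) set \<Rightarrow> real" where
  "dual_dist X \<phi> W = (INF \<psi>\<in>W. opnorm_on X (dual_minus X \<phi> \<psi>))"

text \<open>
  This supremum is taken in \<open>[0, \<infinity>]\<close>, so that the supremum over the empty set is 0: the zero
  space, whose unit sphere is empty, has the empty set as a 1-norming set.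
\<close>

definition one_norming ::
    "'a set \<Rightarrow> ('a::real_normed_vector \<Rightarrow> 'f::real_normed_field) set \<Rightarrow> bool" where
  "one_norming X \<Gamma> \<longleftrightarrow> (\<forall>x\<in>X. ennreal (norm x) = (SUP \<phi>\<in>\<Gamma>. ennreal (norm (\<phi> x))))"

section \<open>Simple ACK structure\<close>

definition simple_ACK ::
    "('f::real_normed_field \<Rightarrow> 'a::real_normed_vector \<Rightarrow> 'a) \<Rightarrow> 'a set \<Rightarrow> bool" where
  "simple_ACK s X \<longleftrightarrow> banach_space_on s X \<and>
     (\<exists>\<Gamma>. \<Gamma> \<subseteq> dual_ball s X \<and> one_norming X \<Gamma> \<and>
       (\<forall>\<epsilon>>0. \<forall>U. openin (subtopology (weak_star s X) \<Gamma>) U \<and> U \<noteq> {} \<longrightarrow>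
         (\<exists>V x1 e F. V \<noteq> {} \<and> V \<subseteq> U \<and> x1 \<in> V \<and> e \<in> X \<and> norm e = 1 \<and> F \<in> operators s X \<and>
           norm (F e) = 1 \<and> opnorm_on X F = 1 \<and>
           x1 (F e) = 1 \<and>
           adjoint_on X F x1 = x1 \<and>
           (\<forall>\<phi>\<in>\<Gamma>. opnorm_on X (adjoint_on X F \<phi>)
              + (1 - \<epsilon>) * opnorm_on X (dual_minus X \<phi> (adjoint_on X F \<phi>)) \<le> 1) \<and>
           (\<forall>\<phi>\<in>\<Gamma>. dual_dist X (adjoint_on X F \<phi>) (dual_aco X (insert (\<lambda>x\<in>X. 0) V)) < \<epsilon>) \<and>
           (\<forall>\<psi>\<in>V. norm (\<psi> e - 1) \<le> \<epsilon>))))"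

section \<open>Uniform algebras\<close>

text \<open>
  On a compact space, \<open>'k \<Rightarrow>\<^sub>C complex\<close> is the space of all continuous functions with the
  supremum norm.  The library provides only its real vector space structure.
\<close>

unbundle bcontfun.lifting

lift_definition bcont_scale ::
    "complex \<Rightarrow> ('k::topological_space \<Rightarrow>\<^sub>C complex) \<Rightarrow> ('k \<Rightarrow>\<^sub>C complex)"
  is "\<lambda>c f x. c * f x"
proof -
  fix c :: complex and f :: "'k \<Rightarrow> complex"
  assume f: "f \<in> bcontfun"
  have "bounded ((\<lambda>z. c * z) ` range f)"
    using f by (intro bounded_linear_image bounded_linear_mult_right) (simp add: bcontfun_def)
  then show "(\<lambda>x. c * f x) \<in> bcontfun"
    using f by (auto simp: bcontfun_def image_image intro!: continuous_intros)
qed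

lift_definition bcont_mult ::
    "('k::topological_space \<Rightarrow>\<^sub>C complex) \<Rightarrow> ('k \<Rightarrow>\<^sub>C complex) \<Rightarrow> ('k \<Rightarrow>\<^sub>C complex)"
  is "\<lambda>f g x. f x * g x"
proof -
  fix f g :: "'k \<Rightarrow> complex"
  assume f: "f \<in> bcontfun" and g: "g \<in> bcontfun"
  obtain B where B: "\<And>x. norm (f x) \<le> B"
    using f by (auto simp: bcontfun_def bounded_iff)
  obtain C where C: "\<And>x. norm (g x) \<le> C"
    using g by (auto simp: bcontfun_def bounded_iff)
  have "norm (f x * g x) \<le> B * C" for x
    unfolding norm_mult
    by (rule mult_mono) (use B[of x] C[of x] order_trans[OF norm_ge_zero B[of x]] in auto)
  then have "bounded (range (\<lambda>x. f x * g x))"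
    by (auto simp: bounded_iff)
  then show "(\<lambda>x. f x * g x) \<in> bcontfun"
    using f g by (auto simp: bcontfun_def intro!: continuous_intros)
qed

interpretation bcont: vector_space bcont_scale
  by unfold_locales (transfer, simp add: algebra_simps)+

text \<open>The unit (constant function 1) is not required to belong to the algebra.\<close>

definition uniform_algebra :: "('k::t2_space \<Rightarrow>\<^sub>C complex) set \<Rightarrow> bool" where
  "uniform_algebra A \<longleftrightarrow>
     compact (UNIV :: 'k set) \<and>
     closed A \<and>
     bcont.subspace A \<and>
     (\<forall>f\<in>A. \<forall>g\<in>A. bcont_mult f g \<in> A) \<and>
     (\<forall>x y. x \<noteq> y \<longrightarrow> (\<exists>f\<in>A. apply_bcontfun f x \<noteq> apply_bcontfun f y))"

end

theory Submission
  imports Defs "HOL-Complex_Analysis.Complex_Analysis"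
begin

text \<open>
  The one-norming set \<open>\<Gamma>\<close> consists of the evaluations at the points of a minimal closed subset
  \<open>S\<close> of the compact space on which every function of the algebra \<open>A\<close> attains its norm; Zorn's
  lemma provides such an \<open>S\<close> (\<open>minimal_closed_norming_set\<close>).  Minimality is what produces
  peaking functions: if \<open>W\<close> is open and meets \<open>S\<close>, then \<open>S - W\<close> is no longer norming, so some
  function of \<open>A\<close> attains its norm in \<open>S \<inter> W\<close> but not in \<open>S - W\<close>.  Scaled, it is a \<open>g\<close> with
  \<open>\<parallel>g\<parallel> = g(t\<^sub>0) = 1\<close> for some \<open>t\<^sub>0\<close> in \<open>S \<inter> W\<close> and, by compactness, \<open>|g| \<le> c < 1\<close> on \<open>S - W\<close>
  (\<open>peaking_function\<close>).

  The operator \<open>F\<close> is the multiplication by a function \<open>f\<close> of \<open>A\<close>, so that the adjoint sends the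
  evaluation \<open>\<delta>\<^sub>t\<close> to \<open>f(t) \<delta>\<^sub>t\<close>, and the norm inequality (IV)' says that \<open>f\<close> maps into the
  Stolz region \<open>|w| + (1 - \<epsilon>) |1 - w| \<le> 1\<close>.  The function is obtained from \<open>g\<close> as
  \<open>f = \<phi> \<circ> g\<close> with \<open>\<phi>(z) = 1 - (1 - z) ^ \<alpha>\<close>.  On the closed unit disc, \<open>1 - z\<close> has argument at
  most \<open>\<pi> / 2\<close> and modulus at most 2.  For a small exponent \<open>\<alpha>\<close>, the power therefore lies in a
  thin sector of radius slightly above 1, which keeps \<open>\<phi>\<close> inside the Stolz region.  Away from
  \<open>z = 1\<close> the power is close to 1, so \<open>\<phi>\<close> is small there, while \<open>\<phi>(1) = 1\<close>
  (\<open>stolz_disc_map\<close>).  Since \<open>\<phi>(0) = 0\<close>, the map \<open>\<phi>\<close> is a uniform limit on the disc of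
  polynomials without constant term, and so \<open>\<phi> \<circ> g\<close> belongs to \<open>A\<close> even if the constants do not
  (\<open>uniform_algebra_disc_calculus\<close>).

  Finally \<open>e = g\<close>, and \<open>V\<close> consists of the evaluations at the points of \<open>S\<close> where \<open>g\<close> is
  \<open>\<delta>\<close>-close to 1.  For \<open>\<delta> \<le> 1 - c\<close> these points lie in \<open>W\<close>.  At a point of \<open>V\<close> the functional
  \<open>f(t) \<delta>\<^sub>t\<close> is a multiple of an element of \<open>V\<close> by a scalar of modulus at most 1, and at the other
  points of \<open>S\<close> it is close to 0 because \<open>\<phi>\<close> is small away from 1; this is condition (V).
\<close>

section \<open>Disc functions with values in a Stolz region\<close>

lemma one_minus_cos_le:
  fixes y :: real
  shows "1 - cos y \<le> y\<^sup>2 / 2"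
proof -
  have "(sin (y/2))\<^sup>2 \<le> (y/2)\<^sup>2"
    using abs_sin_x_le_abs_x[of "y/2"] by (simp only: abs_le_square_iff)
  moreover have "cos y = 1 - 2 * (sin (y/2))\<^sup>2"
    using cos_double_sin[of "y/2"] by simp
  ultimately show ?thesis
    by (simp add: power_divide)
qed

text \<open>
  With \<open>\<rho> = |exp u|\<close> and \<open>\<theta> = Im u\<close>, squaring turns the claim into
  \<open>2 (1 - cos \<theta>) \<le> 2 \<epsilon> - (2 \<epsilon> - \<epsilon>\<^sup>2) \<rho>\<close>.  The right-hand side decreases in \<open>\<rho>\<close> and equals \<open>\<epsilon>\<^sup>2\<close>
  at \<open>\<rho> = 1\<close>, which leaves room for \<open>\<rho>\<close> slightly above 1 and for angles of order \<open>\<epsilon>\<close>.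
\<close>

lemma stolz_exp:
  fixes u :: complex
  assumes "0 < \<epsilon>" "\<epsilon> \<le> 1" "exp (Re u) \<le> 1 + \<epsilon> / 8" "\<bar>Im u\<bar> \<le> \<epsilon> / 2"
  shows "norm (1 - exp u) + (1 - \<epsilon>) * norm (exp u) \<le> 1"
proof -
  define r where "r = exp (Re u)"
  have r: "0 < r" "r \<le> 1 + \<epsilon> / 8"
    using assms by (auto simp: r_def)
  have cos: "1 - cos (Im u) \<le> \<epsilon>\<^sup>2 / 8"
  proof -
    have "(Im u)\<^sup>2 \<le> (\<epsilon> / 2)\<^sup>2"
      using assms by (intro abs_le_square_iff[THEN iffD1]) auto
    then show ?thesis
      using one_minus_cos_le[of "Im u"] by (simp add: power_divide)
  qed
  have "(norm (1 - exp u))\<^sup>2 = (1 - r * cos (Im u))\<^sup>2 + (r * sin (Im u))\<^sup>2"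
    by (simp add: cmod_power2 Re_exp Im_exp r_def)
  also have "\<dots> = 1 - 2 * r * cos (Im u) + r\<^sup>2 * ((sin (Im u))\<^sup>2 + (cos (Im u))\<^sup>2)"
    by (simp add: power2_diff power_mult_distrib algebra_simps
      del: sin_cos_squared_add sin_cos_squared_add2)
  also have "\<dots> = (1 - r)\<^sup>2 + r * (2 * (1 - cos (Im u)))"
    by (simp add: power2_eq_square algebra_simps)
  also have "\<dots> \<le> (1 - r)\<^sup>2 + r * (2 * \<epsilon> - (2 * \<epsilon> - \<epsilon>\<^sup>2) * r)"
  proof -
    have "(2 * \<epsilon> - \<epsilon>\<^sup>2) * r \<le> (2 * \<epsilon> - \<epsilon>\<^sup>2) * (1 + \<epsilon> / 8)"
      using assms r by (intro mult_left_mono) (auto simp: power2_eq_square)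
    also have "\<dots> = 2 * \<epsilon> - 3/4 * \<epsilon>\<^sup>2 - \<epsilon> ^ 3 / 8"
      by (simp add: power2_eq_square power3_eq_cube algebra_simps)
    also have "\<dots> \<le> 2 * \<epsilon> - \<epsilon>\<^sup>2 / 4"
    proof -
      have "\<epsilon> ^ 3 \<ge> 0" "\<epsilon>\<^sup>2 \<ge> 0"
        using assms by auto
      then show ?thesis
        by argo
    qed
    finally have "2 * (1 - cos (Im u)) \<le> 2 * \<epsilon> - (2 * \<epsilon> - \<epsilon>\<^sup>2) * r"
      using cos by argo
    then show ?thesis
      using r by (intro add_left_mono mult_left_mono) auto
  qed
  also have "\<dots> = (1 - (1 - \<epsilon>) * r)\<^sup>2"
    by (simp add: power2_eq_square algebra_simps)
  finally have "(norm (1 - exp u))\<^sup>2 \<le> (1 - (1 - \<epsilon>) * r)\<^sup>2" .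
  moreover have "0 \<le> 1 - (1 - \<epsilon>) * r"
  proof -
    have "(1 - \<epsilon>) * r \<le> (1 - \<epsilon>) * (1 + \<epsilon> / 8)"
      using assms r by (intro mult_left_mono) auto
    also have "\<dots> \<le> 1"
      using assms by (simp add: algebra_simps)
    finally show ?thesis
      by simp
  qed
  ultimately have "norm (1 - exp u) \<le> 1 - (1 - \<epsilon>) * r"
    by (rule power2_le_imp_le)
  then show ?thesis
    by (simp add: r_def)
qed

text \<open>
  The disc map that turns a peaking function into one with values in the Stolz region.  The two
  bounds need only a small exponent: for the first it is compared with \<open>\<epsilon>\<close> alone, since the real
  part of \<open>Ln (1 - z)\<close> is bounded above and its imaginary part is bounded; the second also uses a
  lower bound for the real part, which is where \<open>\<delta>\<close> enters.
\<close>

lemma stolz_disc_map: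
  fixes \<epsilon> \<delta> :: real
  assumes "0 < \<epsilon>" "\<epsilon> \<le> 1" "0 < \<delta>"
  obtains \<phi> :: "complex \<Rightarrow> complex"
  where "continuous_on (cball 0 1) \<phi>" "\<phi> holomorphic_on ball 0 1" "\<phi> 0 = 0" "\<phi> 1 = 1"
    and "\<And>z. norm z \<le> 1 \<Longrightarrow> norm (\<phi> z) + (1 - \<epsilon>) * norm (1 - \<phi> z) \<le> 1"
    and "\<And>z. norm z \<le> 1 \<Longrightarrow> \<delta> \<le> norm (z - 1) \<Longrightarrow> norm (\<phi> z) < \<epsilon>"
proof -
  define M where "M = 3 + \<bar>ln \<delta>\<bar>"
  \<comment> \<open>\<open>M\<close> bounds \<open>|Ln (1 - z)|\<close> on the part of the closed disc where \<open>|z - 1| \<ge> \<delta>\<close>.\<close>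
  define a where "a = \<epsilon> / (16 * M)"
  define \<phi> :: "complex \<Rightarrow> complex" where "\<phi> z = 1 - (1 - z) powr of_real a" for z
  have M: "M \<ge> 3"
    by (simp add: M_def)
  have a: "0 < a" "a \<le> \<epsilon> / 16"
    using assms M by (auto simp: a_def field_simps)
  have Re: "0 \<le> Re (1 - z)" if "norm z \<le> 1" for z
    using complex_Re_le_cmod[of z] that by simp
  have \<phi>_exp: "\<phi> z = 1 - exp (of_real a * Ln (1 - z))" if "z \<noteq> 1" for z
    using that by (simp add: \<phi>_def powr_def)
  have Im_Ln: "\<bar>Im (Ln (1 - z))\<bar> \<le> 2" if "norm z \<le> 1" "z \<noteq> 1" for z
    using Re_Ln_pos_le[of "1 - z"] Re[OF that(1)] that(2) pi_less_4 by simp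
  have Re_Ln: "Re (Ln (1 - z)) \<le> 1" if "norm z \<le> 1" "z \<noteq> 1" for z
  proof -
    have "norm (1 - z) \<le> 2"
      using norm_triangle_ineq4[of 1 z] that by simp
    then have "ln (norm (1 - z)) \<le> ln 2"
      using that by simp
    moreover have "Re (Ln (1 - z)) = ln (norm (1 - z))"
      using that by simp
    ultimately show ?thesis
      using ln_le_minus_one[of "2::real"] by linarith
  qed
  have "continuous_on (cball 0 1) \<phi>"
    unfolding \<phi>_def using a Re by (intro continuous_intros) auto
  moreover have "\<phi> holomorphic_on ball 0 1"
  proof -
    have "1 - z \<notin> \<real>\<^sub>\<le>\<^sub>0" if "z \<in> ball 0 1" for z :: complex
      using complex_Re_le_cmod[of z] that by (auto simp: complex_nonpos_Reals_iff)
    then show ?thesis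
      unfolding \<phi>_def by (intro holomorphic_intros) auto
  qed
  moreover have "\<phi> 0 = 0" "\<phi> 1 = 1"
    by (auto simp: \<phi>_def)
  moreover have "norm (\<phi> z) + (1 - \<epsilon>) * norm (1 - \<phi> z) \<le> 1" if "norm z \<le> 1" for z
  proof (cases "z = 1")
    case False
    define u where "u = of_real a * Ln (1 - z)"
    have "exp (Re u) \<le> exp a"
      using Re_Ln[OF that False] a by (simp add: u_def)
    also have "exp a \<le> 1 + \<epsilon> / 8"
      using norm_exp_bounds(2)[of a] a assms by simp
    finally have "exp (Re u) \<le> 1 + \<epsilon> / 8" .
    moreover have "\<bar>Im u\<bar> \<le> \<epsilon> / 2"
    proof -
      have "\<bar>Im u\<bar> \<le> a * 2"
        using Im_Ln[OF that False] a by (simp add: u_def abs_mult)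
      then show ?thesis
        using a assms by linarith
    qed
    ultimately show ?thesis
      using stolz_exp[of \<epsilon> u] assms False by (simp add: \<phi>_exp u_def)
  qed (simp add: \<phi>_def)
  moreover have "norm (\<phi> z) < \<epsilon>" if "norm z \<le> 1" "\<delta> \<le> norm (z - 1)" for z
  proof -
    have z: "z \<noteq> 1"
      using that assms by auto
    have "ln \<delta> \<le> Re (Ln (1 - z))"
      using that assms z by (simp add: norm_minus_commute)
    then have "\<bar>Re (Ln (1 - z))\<bar> \<le> 1 + \<bar>ln \<delta>\<bar>"
      using Re_Ln[OF that(1) z] by linarith
    then have Ln_le: "norm (Ln (1 - z)) \<le> M"
      using Im_Ln[OF that(1) z] cmod_le[of "Ln (1 - z)"] unfolding M_def by linarith
    have "norm (of_real a * Ln (1 - z)) \<le> \<epsilon> / 16"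
    proof -
      have "norm (of_real a * Ln (1 - z)) \<le> a * M"
        using Ln_le a by (simp add: norm_mult)
      also have "\<dots> = \<epsilon> / 16"
        using M by (simp add: a_def)
      finally show ?thesis .
    qed
    then have "norm (exp (of_real a * Ln (1 - z)) - 1) \<le> 3 / 2 * (\<epsilon> / 16)"
      using norm_exp_bounds(2)[of "of_real a * Ln (1 - z)"] assms by linarith
    then show ?thesis
      using assms z by (simp add: \<phi>_exp norm_minus_commute)
  qed
  ultimately show thesis
    by (rule that)
qed

section \<open>Functional calculus in a uniform algebra\<close>

text \<open>
  The dilation \<open>z \<mapsto> \<phi> (r z)\<close> with \<open>r < 1\<close> is uniformly close to \<open>\<phi>\<close> by uniform continuity, and its
  Taylor series converges absolutely on the closed disc because it is holomorphic beyond it.  The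
  zero at the origin removes the constant term, which makes the approximation usable in an
  algebra without unit.
\<close>

lemma disc_function_approx_poly:
  fixes \<phi> :: "complex \<Rightarrow> complex"
  assumes cont: "continuous_on (cball 0 1) \<phi>" and hol: "\<phi> holomorphic_on ball 0 1"
    and zero: "\<phi> 0 = 0" and "0 < \<epsilon>"
  obtains c :: "nat \<Rightarrow> complex" and N :: nat
  where "\<And>z. norm z \<le> 1 \<Longrightarrow> norm (\<phi> z - (\<Sum>k<N. c k * z ^ Suc k)) < \<epsilon>"
proof -
  have "uniformly_continuous_on (cball 0 1) \<phi>"
    using cont by (intro compact_uniformly_continuous) auto
  from uniformly_continuous_onE[OF this half_gt_zero[OF \<open>0 < \<epsilon>\<close>]]
  obtain d where d: "0 < d" and
    ucont: "\<And>z w. z \<in> cball 0 1 \<Longrightarrow> w \<in> cball 0 1 \<Longrightarrow> dist w z < d \<Longrightarrow> dist (\<phi> w) (\<phi> z) < \<epsilon> / 2"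
    by blast
  define r where "r = 1 - min (1/2) (d/2)"
  have r: "0 < r" "r < 1" "1 - r < d"
    using d by (auto simp: r_def)
  define b where "b n = (deriv ^^ n) \<phi> 0 / fact n * of_real r ^ n" for n
  have sums: "(\<lambda>n. b n * z ^ n) sums \<phi> (of_real r * z)" if "norm z < 1 / r" for z
    using holomorphic_power_series[OF hol, of "of_real r * z"] that r
    by (simp add: b_def norm_mult field_simps)
  \<comment> \<open>The point \<open>(1 + 1 / r) / 2\<close> lies strictly between 1 and the radius \<open>1 / r\<close>.\<close>
  have "summable (\<lambda>n. norm (b n * 1 ^ n))"
  proof (rule powser_insidea)
    show "summable (\<lambda>n. b n * of_real ((1 + 1 / r) / 2) ^ n)"
      using r by (intro sums_summable[OF sums]) (simp only: norm_of_real, simp add: field_simps)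
    show "norm (1::complex) < norm (of_real ((1 + 1 / r) / 2) :: complex)"
      using r by (simp only: norm_of_real) (simp add: field_simps)
  qed
  then have summ: "summable (\<lambda>n. norm (b n))"
    by simp
  then obtain N where N: "norm (\<Sum>n. norm (b (n + N))) < \<epsilon> / 2"
    using suminf_exist_split[of "\<epsilon> / 2" "\<lambda>n. norm (b n)"] \<open>0 < \<epsilon>\<close> by auto
  \<comment> \<open>The partial sum of degree \<open>N\<close> has \<open>Suc N\<close> terms, the first of which vanishes.\<close>
  have N': "norm (\<Sum>n. norm (b (n + Suc N))) < \<epsilon> / 2"
  proof -
    have "summable (\<lambda>n. norm (b (n + N)))"
      using summ by (rule summable_ignore_initial_segment)
    from suminf_split_head[OF this]
    have "(\<Sum>n. norm (b (n + Suc N))) = (\<Sum>n. norm (b (n + N))) - norm (b N)"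
      by simp
    moreover have "0 \<le> (\<Sum>n. norm (b (n + Suc N)))"
      using summable_ignore_initial_segment[OF summ, of "Suc N"] by (intro suminf_nonneg) auto
    ultimately show ?thesis
      using N norm_ge_zero[of "b N"] by (simp only: real_norm_def)
  qed
  have b0: "b 0 = 0"
    by (simp add: b_def zero)
  have "norm (\<phi> z - (\<Sum>k<N. b (Suc k) * z ^ Suc k)) < \<epsilon>" if z: "norm z \<le> 1" for z
  proof -
    have tail: "norm (\<phi> (of_real r * z) - (\<Sum>n<Suc N. b n * z ^ n)) < \<epsilon> / 2"
    proof -
      have "norm z < 1 / r"
      proof -
        have "1 < 1 / r"
          using r by simp
        then show ?thesis
          using z by linarith
      qed
      note s = sums[OF this]
      have "\<phi> (of_real r * z) - (\<Sum>n<Suc N. b n * z ^ n) = (\<Sum>n. b (n + Suc N) * z ^ (n + Suc N))"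
        using suminf_split_initial_segment[OF sums_summable[OF s], of "Suc N"] sums_unique[OF s] by simp
      also have "norm \<dots> \<le> (\<Sum>n. norm (b (n + Suc N)))"
      proof (rule norm_suminf_le)
        show "norm (b (n + Suc N) * z ^ (n + Suc N)) \<le> norm (b (n + Suc N))" for n
          using power_le_one[OF norm_ge_zero z, of "n + Suc N"]
          by (simp only: norm_mult norm_power) (intro mult_left_le, auto)
      qed (use summable_ignore_initial_segment[OF summ, of "Suc N"] in simp)
      also have "\<dots> < \<epsilon> / 2"
        using N' by (simp add: abs_if split: if_splits)
      finally show ?thesis .
    qed
    have "norm (of_real r * z - z) < d"
    proof -
      have "of_real r * z - z = of_real (r - 1) * z"
        by (simp add: algebra_simps)
      then have "norm (of_real r * z - z) = \<bar>r - 1\<bar> * norm z"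
        by (simp only: norm_mult norm_of_real)
      also have "\<dots> \<le> \<bar>r - 1\<bar> * 1"
        using z by (intro mult_left_mono) auto
      finally show ?thesis
        using r by simp
    qed
    moreover have "norm (of_real r * z) \<le> 1"
      using z r by (simp add: norm_mult mult_le_one)
    ultimately have "norm (\<phi> (of_real r * z) - \<phi> z) < \<epsilon> / 2"
      using ucont[of z "of_real r * z"] z by (simp add: dist_norm)
    then have "norm (\<phi> z - (\<Sum>n<Suc N. b n * z ^ n)) < \<epsilon>"
      using tail norm_triangle_ineq[of "\<phi> z - \<phi> (of_real r * z)"
        "\<phi> (of_real r * z) - (\<Sum>n<Suc N. b n * z ^ n)"]
      by (simp add: norm_minus_commute del: sum.lessThan_Suc)
    also have "(\<Sum>n<Suc N. b n * z ^ n) = (\<Sum>k<N. b (Suc k) * z ^ Suc k)"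
      by (simp only: sum.lessThan_Suc_shift b0) simp
    finally show ?thesis .
  qed
  then show thesis
    by (rule that[where c = "\<lambda>k. b (Suc k)"])
qed

lemma uniform_algebra_add: "uniform_algebra A \<Longrightarrow> f \<in> A \<Longrightarrow> g \<in> A \<Longrightarrow> f + g \<in> A"
  and uniform_algebra_scale: "uniform_algebra A \<Longrightarrow> f \<in> A \<Longrightarrow> bcont_scale c f \<in> A"
  and uniform_algebra_mult: "uniform_algebra A \<Longrightarrow> f \<in> A \<Longrightarrow> g \<in> A \<Longrightarrow> bcont_mult f g \<in> A"
  and uniform_algebra_zero: "uniform_algebra A \<Longrightarrow> 0 \<in> A"
  by (auto simp: uniform_algebra_def bcont.subspace_def)

lemma uniform_algebra_poly:
  assumes A: "uniform_algebra A" and g: "g \<in> A"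
  shows "\<exists>p\<in>A. \<forall>t. apply_bcontfun p t = (\<Sum>k<N. c k * apply_bcontfun g t ^ Suc k)"
proof (induction N)
  case 0
  show ?case
    using uniform_algebra_zero[OF A] by (intro bexI[of _ 0]) auto
next
  case (Suc N)
  have "\<exists>q\<in>A. \<forall>t. apply_bcontfun q t = apply_bcontfun g t ^ Suc n" for n
  proof (induction n)
    case (Suc n)
    then obtain q where q: "q \<in> A" "\<And>t. apply_bcontfun q t = apply_bcontfun g t ^ Suc n"
      by blast
    show ?case
      using q g A by (intro bexI[of _ "bcont_mult g q"])
        (auto simp: bcont_mult.rep_eq uniform_algebra_mult)
  qed (use g in auto)
  then obtain q where q: "q \<in> A" "\<And>t. apply_bcontfun q t = apply_bcontfun g t ^ Suc N"
    by blast
  obtain p where p: "p \<in> A" "\<And>t. apply_bcontfun p t = (\<Sum>k<N. c k * apply_bcontfun g t ^ Suc k)"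
    using Suc.IH by blast
  show ?case
    using p q A by (intro bexI[of _ "p + bcont_scale (c N) q"])
      (auto simp: bcont_scale.rep_eq intro!: uniform_algebra_add uniform_algebra_scale)
qed

lemma uniform_algebra_disc_calculus:
  assumes A: "uniform_algebra A" and g: "g \<in> A" "norm g \<le> 1"
    and cont: "continuous_on (cball 0 1) \<phi>" and hol: "\<phi> holomorphic_on ball 0 1"
    and zero: "\<phi> 0 = 0"
  obtains f where "f \<in> A" "\<And>t. apply_bcontfun f t = \<phi> (apply_bcontfun g t)"
proof -
  have g1: "norm (apply_bcontfun g t) \<le> 1" for t
    using norm_bounded[of g t] g by simp
  have "bounded (\<phi> ` cball 0 1)"
    using cont by (intro compact_imp_bounded compact_continuous_image) auto
  then have "bounded (range (\<lambda>t. \<phi> (apply_bcontfun g t)))"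
    by (rule bounded_subset) (use g1 in auto)
  moreover have "continuous_on UNIV (\<lambda>t. \<phi> (apply_bcontfun g t))"
    using g1 by (intro continuous_on_compose2[OF cont]) auto
  ultimately have "(\<lambda>t. \<phi> (apply_bcontfun g t)) \<in> bcontfun"
    by (simp add: bcontfun_def)
  then obtain f where f: "\<And>t. apply_bcontfun f t = \<phi> (apply_bcontfun g t)"
    by (metis bcontfunE)
  have "\<exists>p\<in>A. dist p f < e" if e: "0 < e" for e
  proof -
    obtain c N where c: "\<And>z. norm z \<le> 1 \<Longrightarrow> norm (\<phi> z - (\<Sum>k<N. c k * z ^ Suc k)) < e / 2"
      using disc_function_approx_poly[OF cont hol zero, of "e / 2"] e by auto
    obtain p where p: "p \<in> A" "\<And>t. apply_bcontfun p t = (\<Sum>k<N. c k * apply_bcontfun g t ^ Suc k)"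
      using uniform_algebra_poly[OF A g(1)] by blast
    have "dist p f \<le> e / 2"
    proof (rule dist_bound)
      show "dist (apply_bcontfun p t) (apply_bcontfun f t) \<le> e / 2" for t
        using c[OF g1, of t] by (simp only: p f dist_norm norm_minus_commute)
    qed
    then show ?thesis
      using p e by (intro bexI[of _ p]) auto
  qed
  then have "f \<in> A"
    using A closed_approachable[of A f] by (auto simp: uniform_algebra_def)
  then show thesis
    using that f by blast
qed

section \<open>A minimal closed norming set\<close>

text \<open>
  The zero function is excluded so that the empty set is norming for the zero algebra; the minimal
  norming set is then empty, and so is the set of evaluations used for that algebra.
\<close>

definition norming_set :: "('k::topological_space \<Rightarrow>\<^sub>C complex) set \<Rightarrow> 'k set \<Rightarrow> bool" where
  "norming_set A S \<longleftrightarrow> (\<forall>f\<in>A. f \<noteq> 0 \<longrightarrow> (\<exists>t\<in>S. norm (apply_bcontfun f t) = norm f))"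

lemma norm_attained:
  fixes f :: "'k::topological_space \<Rightarrow>\<^sub>C complex"
  assumes "compact S" "S \<noteq> {}"
  obtains t where "t \<in> S" "\<And>s. s \<in> S \<Longrightarrow> norm (apply_bcontfun f s) \<le> norm (apply_bcontfun f t)"
  using continuous_attains_sup[OF assms, of "\<lambda>t. norm (apply_bcontfun f t)"]
  by (metis continuous_on_apply_bcontfun continuous_on_norm)

lemma norming_set_UNIV:
  fixes A :: "('k::topological_space \<Rightarrow>\<^sub>C complex) set"
  assumes "compact (UNIV :: 'k set)"
  shows "norming_set A UNIV"
  unfolding norming_set_def
proof (intro ballI impI)
  fix f :: "'k \<Rightarrow>\<^sub>C complex"
  obtain t where "\<And>s. norm (apply_bcontfun f s) \<le> norm (apply_bcontfun f t)"
    using norm_attained[OF assms, of f] by auto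
  then have "norm f \<le> norm (apply_bcontfun f t)"
    by (rule norm_bound)
  then show "\<exists>t\<in>UNIV. norm (apply_bcontfun f t) = norm f"
    using norm_bounded[of f t] by force
qed

text \<open>
  Zorn's lemma, applied to the open complements.  If a chain of complements covered the compact
  set where \<open>|f|\<close> attains the norm of \<open>f\<close>, then a single member of the chain would already cover
  it, and its complement would not be norming.
\<close>

lemma minimal_closed_norming_set:
  fixes A :: "('k::t2_space \<Rightarrow>\<^sub>C complex) set"
  assumes comp: "compact (UNIV :: 'k set)"
  obtains S where "closed S" "norming_set A S"
    "\<And>S'. closed S' \<Longrightarrow> norming_set A S' \<Longrightarrow> S' \<subseteq> S \<Longrightarrow> S' = S"
proof -
  define \<W> where "\<W> = {W. open W \<and> norming_set A (- W)}"
  have "\<exists>M\<in>\<W>. \<forall>X\<in>\<W>. M \<subseteq> X \<longrightarrow> X = M"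
  proof (rule subset_Zorn_nonempty)
    show "\<W> \<noteq> {}"
      using norming_set_UNIV[OF comp, of A] by (auto simp: \<W>_def intro!: exI[of _ "{}"])
  next
    fix \<C> assume ne: "\<C> \<noteq> {}" and chain: "subset.chain \<W> \<C>"
    have \<C>: "\<C> \<subseteq> \<W>"
      using chain by (simp add: subset.chain_def)
    have "norming_set A (- \<Union>\<C>)"
      unfolding norming_set_def
    proof (intro ballI impI)
      fix f assume f: "f \<in> A" "f \<noteq> 0"
      show "\<exists>t\<in>- \<Union>\<C>. norm (apply_bcontfun f t) = norm f"
      proof (rule ccontr)
        assume "\<not> ?thesis"
        then have cover: "{t. norm (apply_bcontfun f t) = norm f} \<subseteq> \<Union>\<C>"
          by blast
        have "closed {t. norm (apply_bcontfun f t) = norm f}"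
          by (intro closed_Collect_eq continuous_intros) auto
        then have "compact {t. norm (apply_bcontfun f t) = norm f}"
          using compact_Int_closed[OF comp] by (metis Int_UNIV_left)
        then obtain D where D: "D \<subseteq> \<C>" "finite D" "{t. norm (apply_bcontfun f t) = norm f} \<subseteq> \<Union>D"
          using compactE[OF _ cover] \<C> by (auto simp: \<W>_def)
        obtain W where W: "W \<in> \<C>" "\<Union>D \<subseteq> W"
        proof (cases "D = {}")
          case True
          then show thesis
            using ne that by auto
        next
          case False
          have "subset.chain \<W> D"
            using chain D(1) unfolding subset.chain_def by blast
          then show thesis
            using Union_in_chain[OF D(2) False] D(1) that by blast
        qed
        have "norming_set A (- W)"
          using W \<C> by (auto simp: \<W>_def)
        then show False
          using f D(3) W(2) unfolding norming_set_def by blast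
      qed
    qed
    moreover have "open (\<Union>\<C>)"
      using \<C> by (auto simp: \<W>_def)
    ultimately show "\<Union>\<C> \<in> \<W>"
      by (simp add: \<W>_def)
  qed
  then obtain M where M: "open M" "norming_set A (- M)"
    and max: "\<And>X. open X \<Longrightarrow> norming_set A (- X) \<Longrightarrow> M \<subseteq> X \<Longrightarrow> X = M"
    by (auto simp: \<W>_def)
  show thesis
  proof (rule that[of "- M"])
    fix S' assume "closed S'" "norming_set A S'" "S' \<subseteq> - M"
    then show "S' = - M"
      using max[of "- S'"] by auto
  qed (use M in auto)
qed

lemma norm_bcont_scale: "norm (bcont_scale c f) = norm c * norm f"
proof (rule antisym)
  have *: "norm (bcont_scale c f) \<le> norm c * norm f" for c and f :: "'a \<Rightarrow>\<^sub>C complex"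
    by (intro norm_bound)
      (auto simp: bcont_scale.rep_eq norm_mult intro!: mult_left_mono norm_bounded)
  show "norm (bcont_scale c f) \<le> norm c * norm f"
    by (rule *)
  show "norm c * norm f \<le> norm (bcont_scale c f)"
  proof (cases "c = 0")
    case False
    have "norm f = norm (bcont_scale (inverse c) (bcont_scale c f))"
      using False by simp
    also have "\<dots> \<le> norm (inverse c) * norm (bcont_scale c f)"
      by (rule *)
    finally show ?thesis
      using False by (simp add: norm_divide field_simps)
  qed auto
qed

text \<open>
  By minimality, the closed set \<open>S - W\<close> fails to be norming for some \<open>f\<close>; dividing \<open>f\<close> by its value
  at a point of \<open>S\<close> where it attains its norm gives \<open>g\<close>.
\<close>

lemma peaking_function:
  fixes A :: "('k::t2_space \<Rightarrow>\<^sub>C complex) set"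
  assumes A: "uniform_algebra A"
    and S: "closed S" "norming_set A S"
    and min: "\<And>S'. closed S' \<Longrightarrow> norming_set A S' \<Longrightarrow> S' \<subseteq> S \<Longrightarrow> S' = S"
    and W: "open W" "S \<inter> W \<noteq> {}"
  obtains g t c where "g \<in> A" "norm g = 1" "t \<in> S \<inter> W" "apply_bcontfun g t = 1"
    "c < 1" "\<And>s. s \<in> S - W \<Longrightarrow> norm (apply_bcontfun g s) \<le> c"
proof -
  have comp: "compact (UNIV :: 'k set)"
    using A by (simp add: uniform_algebra_def)
  have cl: "closed (S - W)"
    using S W by auto
  have "\<not> norming_set A (S - W)"
    using min[OF cl] W by blast
  then obtain f where f: "f \<in> A" "f \<noteq> 0" and
    less: "\<And>s. s \<in> S - W \<Longrightarrow> norm (apply_bcontfun f s) \<noteq> norm f"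
    unfolding norming_set_def by blast
  obtain t where t: "t \<in> S" "norm (apply_bcontfun f t) = norm f"
    using S f unfolding norming_set_def by blast
  have tW: "t \<in> S \<inter> W"
    using t less by blast
  have ft: "apply_bcontfun f t \<noteq> 0"
    using t f by auto
  define g where "g = bcont_scale (inverse (apply_bcontfun f t)) f"
  have g: "g \<in> A" "apply_bcontfun g t = 1" "norm g = 1"
    using A f ft t by (auto simp: g_def bcont_scale.rep_eq uniform_algebra_scale norm_bcont_scale norm_inverse)
  have g_less: "norm (apply_bcontfun g s) < 1" if "s \<in> S - W" for s
    using less[OF that] norm_bounded[of f s] f t(2)
    by (simp add: g_def bcont_scale.rep_eq norm_mult norm_divide field_simps)
  obtain c where "c < 1" "\<And>s. s \<in> S - W \<Longrightarrow> norm (apply_bcontfun g s) \<le> c"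
  proof (cases "S - W = {}")
    case True
    then show thesis
      using that[of 0] by auto
  next
    case False
    have "compact (S - W)"
      using compact_Int_closed[OF comp cl] by simp
    from norm_attained[OF this False, of g] show thesis
      using that g_less by metis
  qed
  then show thesis
    using that g tW by blast
qed

section \<open>Evaluation functionals\<close>

definition evaluation :: "('k::topological_space \<Rightarrow>\<^sub>C complex) set \<Rightarrow> 'k \<Rightarrow> ('k \<Rightarrow>\<^sub>C complex) \<Rightarrow> complex" where
  "evaluation A t = (\<lambda>x\<in>A. apply_bcontfun x t)"

lemma opnorm_on_le:
  assumes "0 \<in> X" "\<And>x. x \<in> X \<Longrightarrow> norm x \<le> 1 \<Longrightarrow> norm (T x) \<le> b"
  shows "opnorm_on X T \<le> b"
  unfolding opnorm_on_def by (rule cSUP_least) (use assms in auto)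

lemma opnorm_on_ge:
  assumes "\<And>x. x \<in> X \<Longrightarrow> norm x \<le> 1 \<Longrightarrow> norm (T x) \<le> b" "x \<in> X" "norm x \<le> 1"
  shows "norm (T x) \<le> opnorm_on X T"
  unfolding opnorm_on_def by (rule cSUP_upper) (use assms in \<open>auto simp: bdd_above_def\<close>)

lemma evaluation_bounded: "x \<in> A \<Longrightarrow> norm (evaluation A t x) \<le> norm x"
  by (simp add: evaluation_def norm_bounded)

lemma evaluation_in_dual:
  assumes "uniform_algebra A"
  shows "evaluation A t \<in> dual bcont_scale A"
proof -
  have "\<exists>B. \<forall>x\<in>A. norm (evaluation A t x) \<le> B * norm x"
    by (rule exI[of _ 1]) (use evaluation_bounded in auto)
  then show ?thesis
    using assms by (auto simp: dual_def bounded_linear_on_def evaluation_def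
      uniform_algebra_add uniform_algebra_scale bcont_scale.rep_eq)
qed

text \<open>
  The map \<open>t \<mapsto> \<delta>\<^sub>t\<close> is continuous into the weak-star topology, so a relatively open set of
  evaluations is cut out by an open set of points.
\<close>

lemma open_evaluation_vimage:
  assumes A: "uniform_algebra A" and U: "openin (subtopology (weak_star bcont_scale A) \<Gamma>) U"
    and \<Gamma>: "\<Gamma> \<subseteq> range (evaluation A)"
  obtains W where "open W" "\<And>t. evaluation A t \<in> \<Gamma> \<Longrightarrow> evaluation A t \<in> U \<longleftrightarrow> t \<in> W"
proof -
  obtain T where T: "openin (product_topology (\<lambda>_. euclidean) A) T" "U = T \<inter> (dual bcont_scale A \<inter> \<Gamma>)"
    using U by (auto simp: weak_star_def subtopology_subtopology openin_subtopology)
  have "continuous_map euclidean (product_topology (\<lambda>_. euclidean) A) (evaluation A)"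
    by (auto simp: continuous_map_componentwise evaluation_def)
  then have "openin euclidean {t \<in> topspace euclidean. evaluation A t \<in> T}"
    using T(1) by (rule openin_continuous_map_preimage)
  then have "open {t. evaluation A t \<in> T}"
    by simp
  then show thesis
    by (rule that) (use T(2) evaluation_in_dual[OF A] in auto)
qed

text \<open>
  An infimum of reals is below its members only if these are bounded below.  Here the operator
  norms are nonnegative because the functionals involved are bounded on the unit ball, so that
  each norm is a genuine supremum.
\<close>

lemma dual_dist_le:
  assumes X: "0 \<in> X"
    and \<phi>: "\<And>x. x \<in> X \<Longrightarrow> norm x \<le> 1 \<Longrightarrow> norm (\<phi> x) \<le> b"
    and V: "\<And>v x. v \<in> V \<Longrightarrow> x \<in> X \<Longrightarrow> norm x \<le> 1 \<Longrightarrow> norm (v x) \<le> 1"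
    and \<psi>: "\<psi> \<in> dual_aco X V"
  shows "dual_dist X \<phi> (dual_aco X V) \<le> opnorm_on X (dual_minus X \<phi> \<psi>)"
  unfolding dual_dist_def
proof (rule cINF_lower)
  show "bdd_below ((\<lambda>\<psi>. opnorm_on X (dual_minus X \<phi> \<psi>)) ` dual_aco X V)"
  proof (rule bdd_belowI2)
    fix \<psi> assume "\<psi> \<in> dual_aco X V"
    then obtain T c where T: "\<psi> = (\<lambda>x\<in>X. \<Sum>\<psi>\<in>T. c \<psi> * \<psi> x)" "finite T" "T \<subseteq> V"
      "(\<Sum>\<psi>\<in>T. norm (c \<psi>)) \<le> 1"
      by (auto simp: dual_aco_def)
    have "norm (\<psi> x) \<le> 1" if x: "x \<in> X" "norm x \<le> 1" for x
    proof -
      have "norm (\<psi> x) \<le> (\<Sum>\<psi>\<in>T. norm (c \<psi> * \<psi> x))"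
        using x T(1) by (simp add: norm_sum)
      also have "\<dots> \<le> (\<Sum>\<psi>\<in>T. norm (c \<psi>))"
        using V[OF _ x] T(3) by (intro sum_mono) (auto simp: norm_mult intro!: mult_left_le)
      finally show ?thesis
        using T(4) by linarith
    qed
    then have "norm (dual_minus X \<phi> \<psi> x) \<le> b + 1" if x: "x \<in> X" "norm x \<le> 1" for x
      using \<phi>[OF x] norm_triangle_ineq4[of "\<phi> x" "\<psi> x"] x by (fastforce simp: dual_minus_def)
    from opnorm_on_ge[OF this X]
    have "norm (dual_minus X \<phi> \<psi> 0) \<le> opnorm_on X (dual_minus X \<phi> \<psi>)"
      by simp
    with norm_ge_zero show "0 \<le> opnorm_on X (dual_minus X \<phi> \<psi>)"
      by (rule order_trans)
  qed
qed (rule \<psi>)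

text \<open>
  A Cauchy sequence in the supremum metric converges uniformly, and a uniform limit of bounded
  continuous functions is again bounded and continuous.
\<close>

lemma closed_imp_complete_bcontfun:
  fixes A :: "('a::topological_space \<Rightarrow>\<^sub>C 'b::complete_space) set"
  assumes "closed A"
  shows "complete A"
proof (rule completeI)
  fix f :: "nat \<Rightarrow> _" assume f: "\<forall>n. f n \<in> A" "Cauchy f"
  have "\<exists>M. \<forall>m n. M \<le> m \<and> M \<le> n \<longrightarrow> (\<forall>t. dist (apply_bcontfun (f m) t) (apply_bcontfun (f n) t) < e)" if e: "0 < e" for e
  proof -
    obtain M where "\<And>m n. m \<ge> M \<Longrightarrow> n \<ge> M \<Longrightarrow> dist (f m) (f n) < e"
      using f(2) e unfolding Cauchy_def by blast
    then show ?thesis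
      using dist_fun_lt_imp_dist_val_lt by blast
  qed
  then have "\<exists>g. uniform_limit UNIV (\<lambda>n. apply_bcontfun (f n)) g sequentially"
    using uniformly_convergent_eq_cauchy[of "\<lambda>_. True" "\<lambda>n. apply_bcontfun (f n)"]
    unfolding uniform_limit_sequentially_iff by simp
  then obtain g where "uniform_limit UNIV (\<lambda>n. apply_bcontfun (f n)) g sequentially" ..
  then obtain l where l: "f \<longlonglongrightarrow> l"
    by (rule uniform_limit_bcontfunE) auto
  then have "l \<in> A"
    using closed_sequentially[OF assms] f(1) by blast
  then show "\<exists>l\<in>A. f \<longlonglongrightarrow> l"
    using l by blast
qed

lemma banach_space_on_uniform_algebra:
  fixes A :: "('k::t2_space \<Rightarrow>\<^sub>C complex) set"
  assumes A: "uniform_algebra A"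
  shows "banach_space_on bcont_scale A"
proof (intro banach_space_on.intro banach_space_on_axioms.intro)
  show "vector_space bcont_scale"
    by (rule bcont.vector_space_axioms)
  show "norm (bcont_scale c x) = norm c * norm x" for c and x :: "'k \<Rightarrow>\<^sub>C complex"
    by (rule norm_bcont_scale)
  show "bcont.subspace A"
    using A by (simp add: uniform_algebra_def)
  show "complete A"
    using A by (intro closed_imp_complete_bcontfun) (simp add: uniform_algebra_def)
qed

lemma multiplication_operator:
  assumes A: "uniform_algebra A" and f: "f \<in> A" "norm f \<le> 1"
  shows "bcont_mult f \<in> operators bcont_scale A"
    and "norm (bcont_mult f x) \<le> norm x"
proof -
  show *: "norm (bcont_mult f x) \<le> norm x" for x
  proof (rule norm_bound)
    fix t
    have "norm (apply_bcontfun f t) \<le> 1"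
      using norm_bounded[of f t] f(2) by linarith
    then have "norm (apply_bcontfun (bcont_mult f x) t) \<le> norm (apply_bcontfun x t)"
      by (simp add: bcont_mult.rep_eq norm_mult mult_left_le_one_le)
    then show "norm (apply_bcontfun (bcont_mult f x) t) \<le> norm x"
      using norm_bounded[of x t] by linarith
  qed
  have "\<exists>B. \<forall>x\<in>A. norm (bcont_mult f x) \<le> B * norm x"
    by (rule exI[of _ 1]) (use * in auto)
  moreover have "bcont_mult f (x + y) = bcont_mult f x + bcont_mult f y" for x y
    by (rule bcontfun_eqI) (simp add: bcont_mult.rep_eq distrib_left)
  moreover have "bcont_mult f (bcont_scale c x) = bcont_scale c (bcont_mult f x)" for c x
    by (rule bcontfun_eqI) (simp add: bcont_mult.rep_eq bcont_scale.rep_eq)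
  moreover have "bcont_mult f ` A \<subseteq> A"
    using A f(1) by (auto simp: uniform_algebra_mult)
  ultimately show "bcont_mult f \<in> operators bcont_scale A"
    unfolding operators_def bounded_linear_on_def by simp
qed

theorem corollary4p6:
  fixes A :: "('k::t2_space \<Rightarrow>\<^sub>C complex) set"
  assumes "uniform_algebra A"
  shows "simple_ACK bcont_scale A"
proof -
  note A = assms
  have A0: "0 \<in> A"
    by (rule uniform_algebra_zero[OF A])
  have comp: "compact (UNIV :: 'k set)"
    using A by (simp add: uniform_algebra_def)
  obtain S where S: "closed S" "norming_set A S"
    and min: "\<And>S'. closed S' \<Longrightarrow> norming_set A S' \<Longrightarrow> S' \<subseteq> S \<Longrightarrow> S' = S"
    using minimal_closed_norming_set[OF comp, of A] by blast
  define \<Gamma> where "\<Gamma> = evaluation A ` S"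
  have "opnorm_on A (evaluation A t) \<le> 1" for t
    by (rule opnorm_on_le[OF A0]) (rule order_trans[OF evaluation_bounded])
  then have ball: "\<Gamma> \<subseteq> dual_ball bcont_scale A"
    using evaluation_in_dual[OF A] by (auto simp: \<Gamma>_def dual_ball_def)
  have norming: "one_norming A \<Gamma>"
    unfolding one_norming_def
  proof (intro ballI antisym)
    fix x assume x: "x \<in> A"
    show "(SUP \<phi>\<in>\<Gamma>. ennreal (norm (\<phi> x))) \<le> ennreal (norm x)"
      using evaluation_bounded[OF x] by (auto simp: \<Gamma>_def intro!: SUP_least ennreal_leI)
    show "ennreal (norm x) \<le> (SUP \<phi>\<in>\<Gamma>. ennreal (norm (\<phi> x)))"
    proof (cases "x = 0")
      case False
      then obtain t where t: "t \<in> S" "norm (apply_bcontfun x t) = norm x"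
        using S x unfolding norming_set_def by blast
      then have "ennreal (norm x) = ennreal (norm (evaluation A t x))"
        using x by (simp add: evaluation_def)
      also have "\<dots> \<le> (SUP \<phi>\<in>\<Gamma>. ennreal (norm (\<phi> x)))"
        using t by (intro SUP_upper) (auto simp: \<Gamma>_def)
      finally show ?thesis .
    qed auto
  qed
  have ACK: "\<exists>V x1 e F. V \<noteq> {} \<and> V \<subseteq> U \<and> x1 \<in> V \<and> e \<in> A \<and> norm e = 1 \<and> F \<in> operators bcont_scale A \<and>
           norm (F e) = 1 \<and> opnorm_on A F = 1 \<and>
           x1 (F e) = 1 \<and>
           adjoint_on A F x1 = x1 \<and>
           (\<forall>\<phi>\<in>\<Gamma>. opnorm_on A (adjoint_on A F \<phi>)
              + (1 - \<epsilon>) * opnorm_on A (dual_minus A \<phi> (adjoint_on A F \<phi>)) \<le> 1) \<and>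
           (\<forall>\<phi>\<in>\<Gamma>. dual_dist A (adjoint_on A F \<phi>) (dual_aco A (insert (\<lambda>x\<in>A. 0) V)) < \<epsilon>) \<and>
           (\<forall>\<psi>\<in>V. norm (\<psi> e - 1) \<le> \<epsilon>)"
    if "0 < \<epsilon>" and U: "openin (subtopology (weak_star bcont_scale A) \<Gamma>) U" "U \<noteq> {}" for \<epsilon> :: real and U
  proof -
    have "\<Gamma> \<subseteq> range (evaluation A)"
      by (auto simp: \<Gamma>_def)
    then obtain W where W: "open W" "\<And>t. evaluation A t \<in> \<Gamma> \<Longrightarrow> evaluation A t \<in> U \<longleftrightarrow> t \<in> W"
      using open_evaluation_vimage[OF A U(1)] by blast
    have "U \<subseteq> \<Gamma>"
      using openin_subset[OF U(1)] by auto
    then have "S \<inter> W \<noteq> {}"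
      using U(2) W(2) by (auto simp: \<Gamma>_def)
    then obtain g t0 c where g: "g \<in> A" "norm g = 1" and t0: "t0 \<in> S \<inter> W" "apply_bcontfun g t0 = 1"
      and c: "c < 1" "\<And>s. s \<in> S - W \<Longrightarrow> norm (apply_bcontfun g s) \<le> c"
      using peaking_function[OF A S min W(1)] by blast
    have g1: "norm (apply_bcontfun g t) \<le> 1" for t
      using norm_bounded[of g t] g by simp
    \<comment> \<open>The map \<open>\<phi>\<close> is chosen for \<open>\<eta> \<le> 1\<close>; the conditions become weaker as \<open>\<epsilon>\<close> grows.\<close>
    define \<eta> where "\<eta> = min \<epsilon> 1"
    define \<delta> where "\<delta> = min \<epsilon> (1 - c)"
    have \<eta>: "0 < \<eta>" "\<eta> \<le> 1" "\<eta> \<le> \<epsilon>" and \<delta>: "0 < \<delta>" "\<delta> \<le> \<epsilon>" "\<delta> \<le> 1 - c"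
      using \<open>0 < \<epsilon>\<close> c by (auto simp: \<eta>_def \<delta>_def)
    obtain \<phi> where \<phi>: "continuous_on (cball 0 1) \<phi>" "\<phi> holomorphic_on ball 0 1" "\<phi> 0 = 0" "\<phi> 1 = 1"
      and stolz: "\<And>z. norm z \<le> 1 \<Longrightarrow> norm (\<phi> z) + (1 - \<eta>) * norm (1 - \<phi> z) \<le> 1"
      and small: "\<And>z. norm z \<le> 1 \<Longrightarrow> \<delta> \<le> norm (z - 1) \<Longrightarrow> norm (\<phi> z) < \<eta>"
      using stolz_disc_map[OF \<eta>(1,2) \<delta>(1)] by metis
    obtain f where f: "f \<in> A" "\<And>t. apply_bcontfun f t = \<phi> (apply_bcontfun g t)"
      using uniform_algebra_disc_calculus[OF A g(1) _ \<phi>(1-3)] g(2) by auto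
    have f_stolz: "norm (apply_bcontfun f t) + (1 - \<eta>) * norm (1 - apply_bcontfun f t) \<le> 1" for t
      using stolz[OF g1] by (simp add: f)
    have f1: "norm (apply_bcontfun f t) \<le> 1" for t
    proof -
      have "0 \<le> (1 - \<eta>) * norm (1 - apply_bcontfun f t)"
        using \<eta> by simp
      then show ?thesis
        using f_stolz[of t] by linarith
    qed
    then have norm_f: "norm f \<le> 1"
      by (rule norm_bound)
    have ft0: "apply_bcontfun f t0 = 1"
      by (simp add: f t0 \<phi>)
    define F where "F = bcont_mult f"
    note F = multiplication_operator[OF A f(1) norm_f, folded F_def]
    have FA: "F x \<in> A" if "x \<in> A" for x
      using that A f by (simp add: F_def uniform_algebra_mult)
    have Fg_t0: "apply_bcontfun (F g) t0 = 1"
      by (simp add: F_def bcont_mult.rep_eq ft0 t0)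
    have norm_Fg: "norm (F g) = 1"
      using F(2)[of g] norm_bounded[of "F g" t0] g(2) Fg_t0 by simp
    have opnorm_F: "opnorm_on A F = 1"
    proof (rule antisym)
      show "opnorm_on A F \<le> 1"
        using F(2) by (intro opnorm_on_le[OF A0]) (use order_trans in blast)
      have "norm (F g) \<le> opnorm_on A F"
        using F(2) g by (intro opnorm_on_ge[where b = 1]) (use order_trans in auto)
      then show "1 \<le> opnorm_on A F"
        by (simp add: norm_Fg)
    qed
    have adj: "adjoint_on A F (evaluation A t) = (\<lambda>x\<in>A. apply_bcontfun f t * evaluation A t x)" for t
      using FA by (auto simp: adjoint_on_def evaluation_def F_def bcont_mult.rep_eq)
    have minus: "dual_minus A (evaluation A t) (adjoint_on A F (evaluation A t))
        = (\<lambda>x\<in>A. (1 - apply_bcontfun f t) * evaluation A t x)" for t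
      by (auto simp: dual_minus_def adj algebra_simps)
    have mult_eval_le: "norm ((\<lambda>x\<in>A. a * evaluation A t x) x) \<le> norm a"
      if "x \<in> A" "norm x \<le> 1" for a t x
    proof -
      have "norm (evaluation A t x) \<le> 1"
        using evaluation_bounded[OF that(1), of t] that(2) by linarith
      then show ?thesis
        using that by (simp add: norm_mult mult_left_le)
    qed
    have opnorm_mult: "opnorm_on A (\<lambda>x\<in>A. a * evaluation A t x) \<le> norm a" for a t
      using mult_eval_le by (intro opnorm_on_le[OF A0])
    define V where "V = evaluation A ` {t \<in> S. norm (apply_bcontfun g t - 1) < \<delta>}"
    have x1V: "evaluation A t0 \<in> V"
      using t0 \<delta> by (auto simp: V_def)
    have "V \<subseteq> U"
    proof
      fix \<psi> assume "\<psi> \<in> V"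
      then obtain t where t: "\<psi> = evaluation A t" "t \<in> S" "norm (apply_bcontfun g t - 1) < \<delta>"
        by (auto simp: V_def)
      have "t \<in> W"
      proof (rule ccontr)
        assume "t \<notin> W"
        then have "norm (apply_bcontfun g t) \<le> c"
          using c t by auto
        then have "1 - c \<le> norm (apply_bcontfun g t - 1)"
          using norm_triangle_ineq2[of 1 "apply_bcontfun g t"] by (simp add: norm_minus_commute)
        then show False
          using t(3) \<delta>(3) by linarith
      qed
      then show "\<psi> \<in> U"
        using W(2)[of t] t by (auto simp: \<Gamma>_def)
    qed
    moreover have "adjoint_on A F (evaluation A t0) = evaluation A t0"
      unfolding adj ft0 by (auto simp: evaluation_def)
    moreover have "opnorm_on A (adjoint_on A F \<psi>)
              + (1 - \<epsilon>) * opnorm_on A (dual_minus A \<psi> (adjoint_on A F \<psi>)) \<le> 1" if "\<psi> \<in> \<Gamma>" for \<psi>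
    proof -
      obtain t where t: "\<psi> = evaluation A t"
        using \<open>\<psi> \<in> \<Gamma>\<close> by (auto simp: \<Gamma>_def)
      define n where "n = opnorm_on A (dual_minus A \<psi> (adjoint_on A F \<psi>))"
      have n: "n \<le> norm (1 - apply_bcontfun f t)"
        unfolding n_def t minus by (rule opnorm_mult)
      have "norm ((\<lambda>x\<in>A. (1 - apply_bcontfun f t) * evaluation A t x) 0) \<le> n"
        unfolding n_def t minus using mult_eval_le A0
        by (intro opnorm_on_ge[where b = "norm (1 - apply_bcontfun f t)"]) auto
      then have "0 \<le> n"
        using norm_ge_zero order_trans by blast
      then have "(1 - \<epsilon>) * n \<le> (1 - \<eta>) * n"
        using \<eta> by (intro mult_right_mono) auto
      also have "\<dots> \<le> (1 - \<eta>) * norm (1 - apply_bcontfun f t)"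
        using n \<eta> by (intro mult_left_mono) auto
      finally have "(1 - \<epsilon>) * n \<le> (1 - \<eta>) * norm (1 - apply_bcontfun f t)" .
      moreover have "opnorm_on A (adjoint_on A F \<psi>) \<le> norm (apply_bcontfun f t)"
        unfolding t adj by (rule opnorm_mult)
      ultimately show ?thesis
        using f_stolz[of t] unfolding n_def by linarith
    qed
    moreover have "dual_dist A (adjoint_on A F \<psi>) (dual_aco A (insert (\<lambda>x\<in>A. 0) V)) < \<epsilon>" if "\<psi> \<in> \<Gamma>" for \<psi>
    proof -
      obtain t where t: "t \<in> S" "\<psi> = evaluation A t"
        using \<open>\<psi> \<in> \<Gamma>\<close> by (auto simp: \<Gamma>_def)
      define V0 where "V0 = insert (\<lambda>x\<in>A. 0) V"
      have dist: "dual_dist A (adjoint_on A F \<psi>) (dual_aco A V0) \<le> opnorm_on A (dual_minus A (adjoint_on A F \<psi>) \<theta>)"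
        if "\<theta> \<in> dual_aco A V0" for \<theta>
      proof (rule dual_dist_le[OF A0 _ _ that])
        show "norm (adjoint_on A F \<psi> x) \<le> norm (apply_bcontfun f t)" if "x \<in> A" "norm x \<le> 1" for x
          unfolding t adj using that by (rule mult_eval_le)
        show "norm (v x) \<le> 1" if "v \<in> V0" "x \<in> A" "norm x \<le> 1" for v x
          using that evaluation_bounded[OF that(2)] by (auto simp: V0_def V_def intro: order_trans)
      qed
      show ?thesis
      proof (cases "norm (apply_bcontfun g t - 1) < \<delta>")
        case True
        have mem: "adjoint_on A F \<psi> \<in> dual_aco A V0"
          unfolding dual_aco_def using True t f1[of t]
          by (auto simp: adj V0_def V_def intro!: exI[of _ "{\<psi>}"] exI[of _ "\<lambda>_. apply_bcontfun f t"])
        have "opnorm_on A (dual_minus A (adjoint_on A F \<psi>) (adjoint_on A F \<psi>)) \<le> 0"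
          by (rule opnorm_on_le[OF A0]) (auto simp: dual_minus_def)
        then show ?thesis
          using dist[OF mem] \<open>0 < \<epsilon>\<close> by (simp add: V0_def)
      next
        case False
        have mem: "(\<lambda>x\<in>A. 0) \<in> dual_aco A V0"
          unfolding dual_aco_def by (auto intro!: exI[of _ "{}"])
        have "dual_minus A (adjoint_on A F \<psi>) (\<lambda>x\<in>A. 0) = (\<lambda>x\<in>A. apply_bcontfun f t * evaluation A t x)"
          by (auto simp: dual_minus_def adj t)
        then have "opnorm_on A (dual_minus A (adjoint_on A F \<psi>) (\<lambda>x\<in>A. 0)) \<le> norm (apply_bcontfun f t)"
          using opnorm_mult by metis
        moreover have "norm (apply_bcontfun f t) < \<eta>"
          using small[OF g1, of t] False by (simp add: f)
        ultimately show ?thesis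
          using dist[OF mem] \<eta>(3) by (simp add: V0_def)
      qed
    qed
    moreover have "norm (\<psi> g - 1) \<le> \<epsilon>" if "\<psi> \<in> V" for \<psi>
      using that \<delta>(2) g(1) by (auto simp: V_def evaluation_def)
    moreover have "evaluation A t0 (F g) = 1"
      using FA[OF g(1)] Fg_t0 by (simp add: evaluation_def)
    ultimately show ?thesis
      using x1V g F(1) norm_Fg opnorm_F
      by (intro exI[of _ V] exI[of _ "evaluation A t0"] exI[of _ g] exI[of _ F]) blast
  qed
  show ?thesis
    unfolding simple_ACK_def
    by (rule conjI[OF banach_space_on_uniform_algebra[OF A] exI[of _ \<Gamma>]], rule conjI[OF ball],
        rule conjI[OF norming], intro allI impI, elim conjE, rule ACK)
qed

end
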